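(* Let $S$ be an étale semicategory. Then the open sections of $S$ form a restriction semigroup (under the setwise product) relative to the open subsets of $S^0$. If in addition $S^2$ is closed in $S\times S$, then the compact open sections of $S$ form a restriction semigroup relative to the compact open subsets of $S^0$.
   Context: **Semicategories.** A semigroupoid is a set $S$ with a product defined on some pairs $S^2\subseteq S\times S$ such that $(ab)c$ is defined iff $a(bc)$ is defined, in which case they are equal. Its units are $S^0=\{u\in S:\forall a\in S\ [(u,a)\in S^2\Rightarrow ua=a]\text{ and }[(a,u)\in S^2\Rightarrow au=a]\}$. The source unit $\mathsf s(a)$ of $a$ is the (unique, if it exists) $u\in S^0$ with $(a,u)\in S^2$; the range unit $\mathsf r(a)$ is the (unique, if it exists) $u\in S^0$ with $(u,a)\in S^2$. $S$ is a semicategory if every $a\in S$ has a source unit and $S^2=\{(a,b):\mathsf r(b)\text{ exists and }\mathsf s(a)=\mathsf r(b)\}$. $S^0S$ denotes the set of elements having a range unit. **Étale.** A semicategory with a topology is topological if $\mathsf s$ (on $S$), $\mathsf r$ (on $S^0S$) and the product (on $S^2$) are continuous. It is étale if it is topological, $S^0S$ is open in $S$ and $\mathsf s:S\to S$ is a locally injective open map. **Sections.** A section of $S$ is a subset on which $\mathsf s$ is injective. The product of subsets $T,U\subseteq S$ is $TU=\{tu: t\in T,\ u\in U,\ (t,u)\in S^2\}$. **Restriction semigroups.** Let $B$ be a semigroup with a distinguished commutative subsemigroup $P$ of idempotents ("projections"). Write $a\leq b$ iff $a=bp$ for some $p\in P$. The source projection of $a$, if it exists, is $\min\{p\in P:ap=a\}$,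 denoted $\mathsf s(a)$. $B$ is a restriction semigroup relative to $P$ if every element has a source projection (then $\leq$ is a partial order), $\mathsf s(ab)=\mathsf s(\mathsf s(a)b)$ for all $a,b\in B$, and $pb\leq b$ for all $p\in P$, $b\in B$. *)

theory Defs
  imports "HOL-Analysis.Analysis"
begin

text \<open>
  A partial product is encoded by the set \<open>S2\<close> of composable pairs together with a total
  HOL function, whose values outside \<open>S2\<close> are never used. Accordingly, ``\<open>(ab)c\<close> is
  defined'' reads \<open>(a, b) \<in> S2 \<and> (a \<cdot> b, c) \<in> S2\<close>, and similarly for \<open>a(bc)\<close>.
\<close>

locale semigroupoid =
  fixes S :: "'a set"
    and S2 :: "('a \<times> 'a) set"
    and mult :: "'a \<Rightarrow> 'a \<Rightarrow> 'a" (infixl "\<cdot>" 70)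
  assumes S2_subset: "S2 \<subseteq> S \<times> S"
    and mult_closed: "(a, b) \<in> S2 \<Longrightarrow> a \<cdot> b \<in> S"
    and assoc_defined: "\<lbrakk>a \<in> S; b \<in> S; c \<in> S\<rbrakk> \<Longrightarrow>
      (a, b) \<in> S2 \<and> (a \<cdot> b, c) \<in> S2 \<longleftrightarrow> (b, c) \<in> S2 \<and> (a, b \<cdot> c) \<in> S2"
    and assoc: "\<lbrakk>(a, b) \<in> S2; (a \<cdot> b, c) \<in> S2\<rbrakk> \<Longrightarrow> (a \<cdot> b) \<cdot> c = a \<cdot> (b \<cdot> c)"
begin

definition units :: "'a set" where
  "units = {u \<in> S. \<forall>a\<in>S. ((u, a) \<in> S2 \<longrightarrow> u \<cdot> a = a) \<and> ((a, u) \<in> S2 \<longrightarrow> a \<cdot> u = a)}"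

definition is_source_unit :: "'a \<Rightarrow> 'a \<Rightarrow> bool" where
  "is_source_unit a u \<longleftrightarrow> u \<in> units \<and> (a, u) \<in> S2"

definition is_range_unit :: "'a \<Rightarrow> 'a \<Rightarrow> bool" where
  "is_range_unit a u \<longleftrightarrow> u \<in> units \<and> (u, a) \<in> S2"

lemma is_source_unit_unique:
  assumes "is_source_unit a u" "is_source_unit a v"
  shows "u = v"
proof -
  have S: "a \<in> S" "u \<in> S" "v \<in> S"
    using assms S2_subset by (auto simp: is_source_unit_def)
  have "a \<cdot> u = a"
    using assms(1) S by (auto simp: is_source_unit_def units_def)
  then have "(u, v) \<in> S2"
    using assoc_defined[OF S] assms by (auto simp: is_source_unit_def)
  then show ?thesis
    using assms S by (auto simp: is_source_unit_def units_def)
qed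

lemma is_range_unit_unique:
  assumes "is_range_unit a u" "is_range_unit a v"
  shows "u = v"
proof -
  have S: "u \<in> S" "v \<in> S" "a \<in> S"
    using assms S2_subset by (auto simp: is_range_unit_def)
  have "v \<cdot> a = a"
    using assms(2) S by (auto simp: is_range_unit_def units_def)
  then have "(u, v) \<in> S2"
    using assoc_defined[OF S] assms by (auto simp: is_range_unit_def)
  then show ?thesis
    using assms S by (auto simp: is_range_unit_def units_def)
qed

definition source :: "'a \<Rightarrow> 'a" where
  "source a = (THE u. is_source_unit a u)"

definition range_unit :: "'a \<Rightarrow> 'a" where
  "range_unit a = (THE u. is_range_unit a u)"

text \<open>The set usually written \<open>S\<^sup>0S\<close>.\<close>

definition ranged :: "'a set" where
  "ranged = {a \<in> S. \<exists>u. is_range_unit a u}"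

definition is_section :: "'a set \<Rightarrow> bool" where
  "is_section T \<longleftrightarrow> T \<subseteq> S \<and> inj_on source T"

definition set_mult :: "'a set \<Rightarrow> 'a set \<Rightarrow> 'a set" where
  "set_mult T U = {t \<cdot> u | t u. t \<in> T \<and> u \<in> U \<and> (t, u) \<in> S2}"

end

locale semicategory = semigroupoid +
  assumes source_exists: "a \<in> S \<Longrightarrow> \<exists>u. is_source_unit a u"
    and S2_eq: "S2 = {(a, b). a \<in> S \<and> b \<in> ranged \<and> source a = range_unit b}"

locale topological_semicategory = semicategory S S2 mult
  for S :: "'a set" and S2 :: "('a \<times> 'a) set" and mult :: "'a \<Rightarrow> 'a \<Rightarrow> 'a" (infixl "\<cdot>" 70) +
  fixes X :: "'a topology"
  assumes topspace_eq: "topspace X = S"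
    and continuous_source: "continuous_map X X source"
    and continuous_range: "continuous_map (subtopology X ranged) X range_unit"
    and continuous_mult:
      "continuous_map (subtopology (prod_topology X X) S2) X (\<lambda>(a, b). a \<cdot> b)"

locale etale_semicategory = topological_semicategory +
  assumes open_ranged: "openin X ranged"
    and source_locally_injective: "a \<in> S \<Longrightarrow> \<exists>U. openin X U \<and> a \<in> U \<and> inj_on source U"
    and open_source: "open_map X X source"

locale semigroup_with_projections =
  fixes B :: "'b set"
    and mult :: "'b \<Rightarrow> 'b \<Rightarrow> 'b" (infixl "\<cdot>" 70)
    and P :: "'b set"
  assumes mult_closed: "\<lbrakk>a \<in> B; b \<in> B\<rbrakk> \<Longrightarrow> a \<cdot> b \<in> B"
    and assoc: "\<lbrakk>a \<in> B; b \<in> B; c \<in> B\<rbrakk> \<Longrightarrow> (a \<cdot> b) \<cdot> c = a \<cdot> (b \<cdot> c)"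
    and P_subset: "P \<subseteq> B"
    and P_closed: "\<lbrakk>p \<in> P; q \<in> P\<rbrakk> \<Longrightarrow> p \<cdot> q \<in> P"
    and P_commute: "\<lbrakk>p \<in> P; q \<in> P\<rbrakk> \<Longrightarrow> p \<cdot> q = q \<cdot> p"
    and P_idem: "p \<in> P \<Longrightarrow> p \<cdot> p = p"
begin

definition le :: "'b \<Rightarrow> 'b \<Rightarrow> bool" where
  "le a b \<longleftrightarrow> (\<exists>p\<in>P. a = b \<cdot> p)"

text \<open>\<open>p\<close> is the \<open>le\<close>-minimum of \<open>{q \<in> P. a \<cdot> q = a}\<close>.\<close>

definition is_source_proj :: "'b \<Rightarrow> 'b \<Rightarrow> bool" where
  "is_source_proj a p \<longleftrightarrow> p \<in> P \<and> a \<cdot> p = a \<and> (\<forall>q\<in>P. a \<cdot> q = a \<longrightarrow> le p q)"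

lemma is_source_proj_unique:
  assumes "is_source_proj a p" "is_source_proj a q"
  shows "p = q"
proof -
  have P: "p \<in> P" "q \<in> P" and "le p q" "le q p"
    using assms by (auto simp: is_source_proj_def)
  then obtain r t where r: "r \<in> P" "p = q \<cdot> r" and t: "t \<in> P" "q = p \<cdot> t"
    by (auto simp: le_def)
  have "q \<cdot> p = p"
    using P r P_idem assoc P_subset by (metis subsetD)
  moreover have "p \<cdot> q = q"
    using P t P_idem assoc P_subset by (metis subsetD)
  ultimately show ?thesis
    using P_commute P by metis
qed

definition source_proj :: "'b \<Rightarrow> 'b" where
  "source_proj a = (THE p. is_source_proj a p)"

end

locale restriction_semigroup = semigroup_with_projections +
  assumes source_proj_exists: "a \<in> B \<Longrightarrow> \<exists>p. is_source_proj a p"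
    and source_proj_mult:
      "\<lbrakk>a \<in> B; b \<in> B\<rbrakk> \<Longrightarrow> source_proj (a \<cdot> b) = source_proj (source_proj a \<cdot> b)"
    and proj_mult_le: "\<lbrakk>p \<in> P; b \<in> B\<rbrakk> \<Longrightarrow> le (p \<cdot> b) b"

end

theory Submission imports Defs begin

text \<open>
  On an open section \<open>W\<close> the source map is a homeomorphism onto an open set, so the product of
  open sections \<open>T\<close> and \<open>W\<close> is the image of the open set \<open>{w \<in> W. r w \<in> s ` T}\<close> under a continuous
  lift \<open>\<phi>\<close> with \<open>s (\<phi> w) = s w\<close>. As \<open>s\<close> is a local homeomorphism, such a lift is open.
  Compactness of products is inherited from \<open>T \<times> W\<close> once \<open>S2\<close> is closed. The restriction semigroup
  axioms are algebraic: they hold in every family of sections closed under products and under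
  \<open>T \<mapsto> s ` T\<close>, with \<open>s ` T\<close> as source projection.
\<close>

section \<open>Source units and composability\<close>

context semicategory
begin

lemma is_source_unit_source: "a \<in> S \<Longrightarrow> is_source_unit a (source a)"
  unfolding source_def using source_exists is_source_unit_unique by (metis (full_types) theI')

lemma source_eqI: "is_source_unit a u \<Longrightarrow> source a = u"
  unfolding source_def using is_source_unit_unique by blast

lemma source_in_units: "a \<in> S \<Longrightarrow> source a \<in> units"
  and composable_source: "a \<in> S \<Longrightarrow> (a, source a) \<in> S2"
  using is_source_unit_source by (auto simp: is_source_unit_def)

lemma units_subset: "units \<subseteq> S"
  by (auto simp: units_def)

lemma composable_iff: "(a, b) \<in> S2 \<longleftrightarrow> a \<in> S \<and> b \<in> ranged \<and> source a = range_unit b"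
  using eqset_imp_iff[OF S2_eq, of "(a, b)"] by simp

lemma composableD:
  assumes "(a, b) \<in> S2"
  shows "a \<in> S" "b \<in> S" "b \<in> ranged" "source a = range_unit b"
  using assms S2_subset composable_iff by auto

lemma mult_unit_right: "\<lbrakk>(a, u) \<in> S2; u \<in> units\<rbrakk> \<Longrightarrow> a \<cdot> u = a"
  and mult_unit_left: "\<lbrakk>(u, a) \<in> S2; u \<in> units\<rbrakk> \<Longrightarrow> u \<cdot> a = a"
  using S2_subset by (auto simp: units_def)

text \<open>The product \<open>u \<cdot> source u\<close> equals \<open>source u\<close> because
  \<open>u\<close> is a unit, and equals \<open>u\<close> because \<open>source u\<close> is
  one.\<close>

lemma source_unit: "u \<in> units \<Longrightarrow> source u = u"
  using composable_source[of u] source_in_units[of u] mult_unit_left mult_unit_right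
    units_subset by (metis subsetD)

lemma composable_unit_right: "\<lbrakk>(a, u) \<in> S2; u \<in> units\<rbrakk> \<Longrightarrow> source a = u"
  by (simp add: is_source_unit_def source_eqI)

text \<open>As \<open>b \<cdot> source b = b\<close>, associativity applied to \<open>a\<close>,
  \<open>b\<close>, \<open>source b\<close> turns the composability of \<open>a\<close> with
  \<open>b\<close> into that of \<open>a \<cdot> b\<close> with \<open>source b\<close>.\<close>

lemma source_mult:
  assumes "(a, b) \<in> S2"
  shows "source (a \<cdot> b) = source b"
proof (rule source_eqI)
  have b: "a \<in> S" "b \<in> S"
    using composableD[OF assms] by auto
  then have "source b \<in> S"
    using source_in_units units_subset by auto
  moreover have "b \<cdot> source b = b"
    using b by (simp add: composable_source mult_unit_right source_in_units)
  ultimately have "(a \<cdot> b, source b) \<in> S2"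
    using assoc_defined[of a b "source b"] b assms composable_source by auto
  then show "is_source_unit (a \<cdot> b) (source b)"
    using b by (simp add: is_source_unit_def source_in_units)
qed

text \<open>Composability sees the left factor only through its source, and \<open>source a\<close>
  is its own source.\<close>

lemma composable_source_left:
  "a \<in> S \<Longrightarrow> (source a, b) \<in> S2 \<longleftrightarrow> (a, b) \<in> S2"
  using source_in_units[of a] source_unit units_subset by (auto simp: composable_iff)

section \<open>Setwise products of sections\<close>

lemma set_multI: "\<lbrakk>t \<in> T; u \<in> U; (t, u) \<in> S2\<rbrakk> \<Longrightarrow> t \<cdot> u \<in> set_mult T U"
  by (auto simp: set_mult_def)

lemma set_mult_assoc:
  assumes "T \<subseteq> S" "U \<subseteq> S" "V \<subseteq> S"
  shows "set_mult (set_mult T U) V = set_mult T (set_mult U V)"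
proof (intro subset_antisym subsetI)
  fix x assume "x \<in> set_mult (set_mult T U) V"
  then obtain t u v where x: "t \<in> T" "u \<in> U" "v \<in> V" "(t, u) \<in> S2" "(t \<cdot> u, v) \<in> S2"
      "x = (t \<cdot> u) \<cdot> v"
    by (auto simp: set_mult_def)
  then have "(u, v) \<in> S2" "(t, u \<cdot> v) \<in> S2"
    using assoc_defined[of t u v] assms by auto
  then show "x \<in> set_mult T (set_mult U V)"
    using x assoc by (auto intro!: set_multI)
next
  fix x assume "x \<in> set_mult T (set_mult U V)"
  then obtain t u v where x: "t \<in> T" "u \<in> U" "v \<in> V" "(u, v) \<in> S2" "(t, u \<cdot> v) \<in> S2"
      "x = t \<cdot> (u \<cdot> v)"
    by (auto simp: set_mult_def)
  then have S2: "(t, u) \<in> S2" "(t \<cdot> u, v) \<in> S2"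
    using assoc_defined[of t u v] assms by auto
  then have "x = (t \<cdot> u) \<cdot> v"
    using x assoc by simp
  then show "x \<in> set_mult (set_mult T U) V"
    using x S2 by (auto intro!: set_multI)
qed

text \<open>The source of \<open>t \<cdot> u\<close> is that of \<open>u\<close>, which determines
  \<open>u\<close> within \<open>U\<close>; the range unit of \<open>u\<close> is the source of
  \<open>t\<close>, which then determines \<open>t\<close> within \<open>T\<close>.\<close>

lemma is_section_set_mult:
  assumes T: "is_section T" and U: "is_section U"
  shows "is_section (set_mult T U)"
  unfolding is_section_def
proof (intro conjI inj_onI)
  show "set_mult T U \<subseteq> S"
    using mult_closed by (auto simp: set_mult_def)
  fix x y assume "x \<in> set_mult T U" "y \<in> set_mult T U" and eq: "source x = source y"
  then obtain t u t' u' where x: "t \<in> T" "u \<in> U" "(t, u) \<in> S2" "x = t \<cdot> u"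
    and y: "t' \<in> T" "u' \<in> U" "(t', u') \<in> S2" "y = t' \<cdot> u'"
    by (auto simp: set_mult_def)
  then have "source u = source u'"
    using eq source_mult by simp
  then have "u = u'"
    using U x y by (auto simp: is_section_def dest: inj_onD)
  moreover from this have "source t = source t'"
    using x y composableD(4) by metis
  then have "t = t'"
    using T x y by (auto simp: is_section_def dest: inj_onD)
  ultimately show "x = y"
    using x y by simp
qed

lemma is_section_units: "U \<subseteq> units \<Longrightarrow> is_section U"
  unfolding is_section_def inj_on_def using units_subset source_unit by (metis subset_iff)

text \<open>A product of composable units equals both factors, so a unit composes with no unit but
  itself. Commutativity and idempotence of the projections thus reduce to those of
  intersection.\<close>

lemma set_mult_units:
  assumes "U \<subseteq> units" "V \<subseteq> units"
  shows "set_mult U V = U \<inter> V"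
proof (intro subset_antisym subsetI)
  fix x assume "x \<in> set_mult U V"
  then obtain u v where x: "u \<in> U" "v \<in> V" "(u, v) \<in> S2" "x = u \<cdot> v"
    by (auto simp: set_mult_def)
  then have "u \<cdot> v = u" "u \<cdot> v = v"
    using assms mult_unit_left mult_unit_right by (meson subsetD)+
  then show "x \<in> U \<inter> V"
    using x by simp
next
  fix x assume x: "x \<in> U \<inter> V"
  then have "x \<in> units"
    using assms by auto
  then have "(x, x) \<in> S2" "x \<cdot> x = x"
    using composable_source[of x] source_unit units_subset mult_unit_left by fastforce+
  then show "x \<in> set_mult U V"
    using x set_multI[of x U x V] by simp
qed

text \<open>Multiplying by units on the right restricts a section to the elements with those
  sources. The case \<open>T = W\<close> shows that the sources of \<open>T\<close> fix
  \<open>T\<close>; in general it turns inclusion of sections into the order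
  \<open>le\<close>.\<close>

lemma set_mult_source_image:
  assumes W: "is_section W" and "T \<subseteq> W"
  shows "set_mult W (source ` T) = T"
proof (intro subset_antisym subsetI)
  fix x assume "x \<in> set_mult W (source ` T)"
  then obtain w t where x: "w \<in> W" "t \<in> T" "(w, source t) \<in> S2" "x = w \<cdot> source t"
    by (auto simp: set_mult_def)
  then have u: "source t \<in> units"
    using assms source_in_units by (auto simp: is_section_def)
  then have "source w = source t"
    using x composable_unit_right by blast
  then have "w = t"
    using assms x by (auto simp: is_section_def dest: inj_onD)
  then show "x \<in> T"
    using x u mult_unit_right by simp
next
  fix t assume t: "t \<in> T"
  then have "t \<in> S"
    using assms by (auto simp: is_section_def)
  then have "(t, source t) \<in> S2" "t \<cdot> source t = t"
    using composable_source mult_unit_right source_in_units by auto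
  then show "t \<in> set_mult W (source ` T)"
    using t assms(2) set_multI[of t W "source t" "source ` T"] by auto
qed

text \<open>Replacing \<open>t\<close> by \<open>source t\<close> changes neither which
  \<open>u\<close> compose with it nor the source of the product, which is
  \<open>source u\<close>.\<close>

lemma source_set_mult:
  assumes "T \<subseteq> S"
  shows "source ` set_mult T U = source ` set_mult (source ` T) U"
proof (intro subset_antisym subsetI)
  fix x assume "x \<in> source ` set_mult T U"
  then obtain t u where x: "t \<in> T" "u \<in> U" "(t, u) \<in> S2" "x = source (t \<cdot> u)"
    by (auto simp: set_mult_def)
  then have "(source t, u) \<in> S2"
    using assms composable_source_left by auto
  then show "x \<in> source ` set_mult (source ` T) U"
    using x source_mult by (metis imageI set_multI)
next
  fix x assume "x \<in> source ` set_mult (source ` T) U"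
  then obtain t u where x: "t \<in> T" "u \<in> U" "(source t, u) \<in> S2" "x = source (source t \<cdot> u)"
    by (auto simp: set_mult_def)
  then have "(t, u) \<in> S2"
    using assms composable_source_left by auto
  then show "x \<in> source ` set_mult T U"
    using x source_mult by (metis imageI set_multI)
qed

text \<open>The family \<open>B\<close> is left abstract so that open sections and compact open
  sections become two instances.\<close>

theorem restriction_semigroup_sections:
  assumes is_section: "\<And>T. T \<in> B \<Longrightarrow> is_section T"
    and closed: "\<And>T U. \<lbrakk>T \<in> B; U \<in> B\<rbrakk> \<Longrightarrow> set_mult T U \<in> B"
    and source: "\<And>T. T \<in> B \<Longrightarrow> source ` T \<in> B"
  shows "restriction_semigroup B set_mult {U \<in> B. U \<subseteq> units}"
proof -
  let ?P = "{U \<in> B. U \<subseteq> units}"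
  have subS: "T \<subseteq> S" if "T \<in> B" for T
    using is_section[OF that] by (simp add: is_section_def)
  have source_P: "source ` T \<in> ?P" if "T \<in> B" for T
    using that source subS source_in_units by blast
  interpret semigroup_with_projections B set_mult ?P
  proof unfold_locales
    show "set_mult (set_mult T U) V = set_mult T (set_mult U V)"
      if "T \<in> B" "U \<in> B" "V \<in> B" for T U V
      using that subS set_mult_assoc by simp
    show "set_mult U V \<in> ?P" if "U \<in> ?P" "V \<in> ?P" for U V
      using that closed[of U V] set_mult_units by auto
  qed (use closed set_mult_units in auto)
  have source_proj: "is_source_proj T (source ` T)" if T: "T \<in> B" for T
    unfolding is_source_proj_def
  proof (intro conjI ballI impI)
    show "source ` T \<in> ?P"
      using T by (rule source_P)
    show "set_mult T (source ` T) = T"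
      using set_mult_source_image is_section[OF T] by blast
    fix Q assume Q: "Q \<in> ?P" and TQ: "set_mult T Q = T"
    \<comment> \<open>Every element of \<open>T\<close> has the form \<open>t \<cdot> q\<close> with
      \<open>q\<close> in \<open>Q\<close>, and its source is \<open>source q = q\<close>.\<close>
    have "source ` T \<subseteq> Q"
    proof
      fix x assume "x \<in> source ` T"
      then obtain t q where x: "q \<in> Q" "(t, q) \<in> S2" "x = source (t \<cdot> q)"
        using TQ by (force simp: set_mult_def)
      then show "x \<in> Q"
        using Q source_mult source_unit by auto
    qed
    \<comment> \<open>Products of projections are intersections, so inclusion gives the order: the
      smaller projection is itself the required witness.\<close>
    then have "source ` T = set_mult Q (source ` T)"
      using Q source_P[OF T] set_mult_units by auto
    then show "le (source ` T) Q"
      using source_P[OF T] unfolding le_def by blast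
  qed
  have source_proj_eq: "source_proj T = source ` T" if "T \<in> B" for T
    unfolding source_proj_def
    by (rule the_equality) (use source_proj[OF that] is_source_proj_unique in blast)+
  show ?thesis
  proof unfold_locales
    show "\<exists>p. is_source_proj T p" if "T \<in> B" for T
      using that source_proj by blast
    show "source_proj (set_mult T U) = source_proj (set_mult (source_proj T) U)"
      if "T \<in> B" "U \<in> B" for T U
    proof -
      have "source_proj (set_mult T U) = source ` set_mult T U"
        using closed[OF that] by (rule source_proj_eq)
      also have "\<dots> = source ` set_mult (source ` T) U"
        using subS[OF that(1)] by (rule source_set_mult)
      also have "\<dots> = source_proj (set_mult (source ` T) U)"
        using closed[OF source[OF that(1)] that(2)] by (rule source_proj_eq[symmetric])
      finally show ?thesis
        by (simp only: source_proj_eq[OF that(1)])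
    qed
    show "le (set_mult Q T) T" if Q: "Q \<in> ?P" and T: "T \<in> B" for Q T
    proof -
      have QT: "set_mult Q T \<in> B"
        using Q T closed by auto
      \<comment> \<open>Units act trivially from the left, so \<open>set_mult Q T\<close> is a part
        of the section \<open>T\<close> and is cut out of it by its own sources.\<close>
      have "set_mult Q T \<subseteq> T"
        using Q mult_unit_left by (auto simp: set_mult_def)
      then have "set_mult Q T = set_mult T (source ` set_mult Q T)"
        using set_mult_source_image is_section[OF T] by simp
      then show ?thesis
        using source_P[OF QT] unfolding le_def by blast
    qed
  qed
qed

end

section \<open>Topology of sections and their products\<close>

context etale_semicategory
begin

lemma openin_source_image: "openin X T \<Longrightarrow> openin X (source ` T)"
  using open_source by (simp add: open_map_def)

text \<open>Units are their own sources, so \<open>units\<close> is the image of the whole space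
  under the open map \<open>source\<close>.\<close>

lemma openin_units: "openin X units"
proof -
  have "source ` S = units"
    using source_in_units source_unit units_subset by force
  then show ?thesis
    using openin_source_image[of S] topspace_eq by (metis openin_topspace)
qed

lemma continuous_map_source_inverse:
  assumes T: "is_section T" "openin X T"
  shows "continuous_map (subtopology X (source ` T)) X (inv_into T source)"
  unfolding continuous_map_openin_preimage_eq
proof (intro conjI allI impI)
  have inj: "inj_on source T"
    using T by (simp add: is_section_def)
  show "inv_into T source \<in> topspace (subtopology X (source ` T)) \<rightarrow> topspace X"
  proof
    fix x assume "x \<in> topspace (subtopology X (source ` T))"
    then have "inv_into T source x \<in> T"
      by (simp add: inv_into_into)
    then show "inv_into T source x \<in> topspace X"
      using openin_subset[OF T(2)] by blast
  qed
  fix V assume V: "openin X V"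
  \<comment> \<open>The preimage of \<open>V\<close> under the inverse is a direct image under
    \<open>source\<close>, so openness of \<open>source\<close> gives continuity of its
    inverse.\<close>
  have "source ` T \<inter> inv_into T source -` V = source ` (T \<inter> V)"
    using inj by auto
  moreover have "openin X (source ` (T \<inter> V))"
    using T V openin_source_image by blast
  ultimately show "openin (subtopology X (source ` T))
      (topspace (subtopology X (source ` T)) \<inter> inv_into T source -` V)"
    using openin_source_image[OF T(2)]
    by (simp add: Int_absorb1 openin_subset openin_open_subtopology image_mono)
qed

lemma openin_image_lift:
  assumes W: "openin X W" and cont: "continuous_map (subtopology X W) X \<phi>"
    and lift: "\<And>w. w \<in> W \<Longrightarrow> source (\<phi> w) = source w"
  shows "openin X (\<phi> ` W)"
proof (subst openin_subopen, intro ballI)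
  fix x assume "x \<in> \<phi> ` W"
  then obtain w where w: "w \<in> W" "x = \<phi> w"
    by auto
  have WS: "W \<subseteq> topspace X"
    using W openin_subset by blast
  then have "x \<in> S"
    using w cont topspace_eq by (auto simp: continuous_map_def Pi_iff)
  then obtain V where V: "openin X V" "x \<in> V" "inj_on source V"
    using source_locally_injective by blast
  \<comment> \<open>\<open>N\<close> is the part of \<open>W\<close> that \<open>\<phi>\<close>
    sends into \<open>V\<close>. \<open>M\<close> collects the points of \<open>V\<close> lying over
    the sources of \<open>N\<close>; it is open since \<open>source\<close> is both open and
    continuous.\<close>
  define N where "N = {w \<in> W. \<phi> w \<in> V}"
  have N: "openin X N"
    using openin_continuous_map_preimage[OF cont V(1)] W WS
    by (simp add: N_def openin_open_subtopology Int_absorb1)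
  define M where "M = {y \<in> V. source y \<in> source ` N}"
  have "{y \<in> topspace X. source y \<in> source ` N} \<inter> V = M"
    using openin_subset[OF V(1)] by (auto simp: M_def)
  then have "openin X M"
    using openin_continuous_map_preimage[OF continuous_source openin_source_image[OF N]] V
    by (metis openin_Int)
  moreover have "x \<in> M"
    using w V lift by (auto simp: M_def N_def)
  moreover have "M \<subseteq> \<phi> ` W"
  proof
    fix y assume "y \<in> M"
    then obtain v where v: "v \<in> W" "\<phi> v \<in> V" "y \<in> V" "source y = source v"
      by (auto simp: M_def N_def)
    \<comment> \<open>Both points lie in \<open>V\<close>, where \<open>source\<close> is injective,
      and both have source \<open>source v\<close>.\<close>
    then have "y = \<phi> v"
      using V(3) lift by (metis inj_onD)
    then show "y \<in> \<phi> ` W"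
      using v by blast
  qed
  ultimately show "\<exists>M. openin X M \<and> x \<in> M \<and> M \<subseteq> \<phi> ` W"
    by blast
qed

lemma openin_set_mult:
  assumes T: "is_section T" "openin X T" and W: "openin X W"
  shows "openin X (set_mult T W)"
proof -
  \<comment> \<open>\<open>W'\<close> consists of the elements of \<open>W\<close> that compose with
    some element of \<open>T\<close>; since \<open>T\<close> is a section, that element is unique,
    and it is \<open>\<tau> w\<close>.\<close>
  define W' where "W' = {w \<in> W \<inter> ranged. range_unit w \<in> source ` T}"
  define \<tau> where "\<tau> w = inv_into T source (range_unit w)" for w
  have TS: "T \<subseteq> S" and inj: "inj_on source T"
    using T by (auto simp: is_section_def)
  have ranged: "ranged \<subseteq> topspace X"
    using open_ranged openin_subset by blast
  have "openin X {w \<in> ranged. range_unit w \<in> source ` T}"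
    using openin_continuous_map_preimage[OF continuous_range openin_source_image[OF T(2)]]
      open_ranged ranged by (simp add: openin_open_subtopology Int_absorb1)
  moreover have "W' = W \<inter> {w \<in> ranged. range_unit w \<in> source ` T}"
    by (auto simp: W'_def)
  ultimately have W': "openin X W'"
    using W by auto
  have \<tau>: "\<tau> w \<in> T" "source (\<tau> w) = range_unit w" if "w \<in> W'" for w
    using that by (auto simp: W'_def \<tau>_def inv_into_into f_inv_into_f)
  then have S2: "(\<tau> w, w) \<in> S2" if "w \<in> W'" for w
    using that TS by (auto simp: W'_def simp: composable_iff)
  have "continuous_map (subtopology X W') (subtopology X (source ` T)) range_unit"
    unfolding continuous_map_in_subtopology
  proof
    show "continuous_map (subtopology X W') X range_unit"
      using continuous_range by (rule continuous_map_from_subtopology_mono) (auto simp: W'_def)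
  qed (auto simp: W'_def)
  then have "continuous_map (subtopology X W') X \<tau>"
    using continuous_map_compose[OF _ continuous_map_source_inverse[OF T]]
    by (simp add: \<tau>_def[abs_def] comp_def)
  then have "continuous_map (subtopology X W') (subtopology (prod_topology X X) S2) (\<lambda>w. (\<tau> w, w))"
    unfolding continuous_map_in_subtopology
    using S2 by (auto simp: continuous_map_pairwise comp_def)
  from continuous_map_compose[OF this continuous_mult]
  have "continuous_map (subtopology X W') X (\<lambda>w. \<tau> w \<cdot> w)"
    by (simp add: comp_def)
  \<comment> \<open>The source of \<open>\<tau> w \<cdot> w\<close> is that of \<open>w\<close>, so
    this map is a continuous lift.\<close>
  then have "openin X ((\<lambda>w. \<tau> w \<cdot> w) ` W')"
    using W' S2 source_mult by (intro openin_image_lift) auto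
  also have "(\<lambda>w. \<tau> w \<cdot> w) ` W' = set_mult T W"
  proof (intro subset_antisym subsetI)
    fix x assume "x \<in> (\<lambda>w. \<tau> w \<cdot> w) ` W'"
    then show "x \<in> set_mult T W"
      using \<tau> S2 by (auto simp: W'_def intro!: set_multI)
  next
    fix x assume "x \<in> set_mult T W"
    then obtain t w where x: "t \<in> T" "w \<in> W" "(t, w) \<in> S2" "x = t \<cdot> w"
      by (auto simp: set_mult_def)
    then have "source t = range_unit w" "w \<in> ranged"
      using composableD by blast+
    then have w: "w \<in> W'" and "source t = range_unit w"
      using x by (auto simp: W'_def intro!: rev_image_eqI)
    then have "\<tau> w = t"
      using inj x by (metis \<tau>_def inv_into_f_f)
    then show "x \<in> (\<lambda>w. \<tau> w \<cdot> w) ` W'"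
      using x w by blast
  qed
  finally show ?thesis .
qed

lemma compactin_set_mult:
  assumes "closedin (prod_topology X X) S2" "compactin X T" "compactin X U"
  shows "compactin X (set_mult T U)"
proof -
  have "compactin (prod_topology X X) (S2 \<inter> T \<times> U)"
    using assms by (intro closed_Int_compactin) (auto simp: compactin_Times)
  \<comment> \<open>Compactness is moved into the subspace \<open>S2\<close>, the domain on which
    the product is continuous.\<close>
  then have "compactin (subtopology (prod_topology X X) S2) (S2 \<inter> T \<times> U)"
    by (simp add: compactin_subtopology)
  from image_compactin[OF this continuous_mult]
  have "compactin X ((\<lambda>(a, b). a \<cdot> b) ` (S2 \<inter> T \<times> U))" .
  also have "(\<lambda>(a, b). a \<cdot> b) ` (S2 \<inter> T \<times> U) = set_mult T U"
    by (force simp: set_mult_def)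
  finally show ?thesis .
qed

section \<open>Open sections and compact open sections\<close>

lemma is_section_source_image: "T \<subseteq> S \<Longrightarrow> is_section (source ` T)"
  using is_section_units source_in_units by blast

lemma restriction_semigroup_open_sections:
  "restriction_semigroup {T. is_section T \<and> openin X T} set_mult
     {U. openin (subtopology X units) U}"
proof -
  \<comment> \<open>As \<open>units\<close> is open, the relatively open subsets of it are the open
    sets contained in it, and all of these are sections.\<close>
  have "{U. openin (subtopology X units) U} = {U \<in> {T. is_section T \<and> openin X T}. U \<subseteq> units}"
    using openin_open_subtopology[OF openin_units] is_section_units by auto
  moreover have "restriction_semigroup {T. is_section T \<and> openin X T} set_mult \<dots>"
    by (rule restriction_semigroup_sections)
      (auto simp: is_section_set_mult openin_set_mult openin_source_image
         is_section_source_image[OF openin_subset[of X, unfolded topspace_eq]])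
  ultimately show ?thesis
    by simp
qed

lemma restriction_semigroup_compact_open_sections:
  assumes "closedin (prod_topology X X) S2"
  shows "restriction_semigroup {T. is_section T \<and> compactin X T \<and> openin X T} set_mult
     {U. compactin X U \<and> openin (subtopology X units) U}"
proof -
  have "{U. compactin X U \<and> openin (subtopology X units) U} =
      {U \<in> {T. is_section T \<and> compactin X T \<and> openin X T}. U \<subseteq> units}"
    using openin_open_subtopology[OF openin_units] is_section_units by auto
  \<comment> \<open>Closure under sources now also needs compactness of the image of
    \<open>T\<close> under \<open>source\<close>, which continuity of \<open>source\<close>
    provides.\<close>
  moreover have
    "restriction_semigroup {T. is_section T \<and> compactin X T \<and> openin X T} set_mult \<dots>"
    by (rule restriction_semigroup_sections)
      (auto simp: is_section_set_mult openin_set_mult openin_source_image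
         compactin_set_mult[OF assms] image_compactin[OF _ continuous_source]
         is_section_source_image[OF openin_subset[of X, unfolded topspace_eq]])
  ultimately show ?thesis
    by simp
qed

end

theorem proposition4p8:
  fixes S :: "'a set"
    and S2 :: "('a \<times> 'a) set"
    and mult :: "'a \<Rightarrow> 'a \<Rightarrow> 'a"
    and X :: "'a topology"
  assumes "etale_semicategory S S2 mult X"
  shows "restriction_semigroup
           {T. semigroupoid.is_section S S2 mult T \<and> openin X T}
           (semigroupoid.set_mult S2 mult)
           {U. openin (subtopology X (semigroupoid.units S S2 mult)) U}
       \<and> (closedin (prod_topology X X) S2 \<longrightarrow>
         restriction_semigroup
           {T. semigroupoid.is_section S S2 mult T \<and> compactin X T \<and> openin X T}
           (semigroupoid.set_mult S2 mult)
           {U. compactin X U \<and> openin (subtopology X (semigroupoid.units S S2 mult)) U})"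
proof -
  interpret etale_semicategory S S2 mult X
    by (fact assms)
  show ?thesis
    using restriction_semigroup_open_sections restriction_semigroup_compact_open_sections by blast
qed

end
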